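(* Let $L$ be any logic such that $\mathbf{IL}^-\subseteq L\subseteq\mathbf{IL}^-(\mathbf{J1},\mathbf{J5})$. Then $L$ has neither $\ell$FPP nor the Craig interpolation property (CIP).
   Context: Formulas are generated by $A ::= \bot \mid p \mid A \to A \mid \Box A \mid A \rhd A$, where $p$ ranges over a countably infinite set of propositional variables. The symbols $\neg,\land,\lor,\leftrightarrow,\top,\Diamond$ (with $\Diamond A := \neg\Box\neg A$) are the usual abbreviations. $\neg,\Box,\Diamond$ bind most strongly. $v(A)$ is the set of propositional variables contained in $A$. For a formula $A(p)$, $A(B)$ denotes the result of substituting $B$ for all occurrences of $p$ in $A(p)$. The logic $\mathbf{IL}^-$ has as axioms all instances of: $\mathbf{L1}$: all tautologies in this language; $\mathbf{L2}$: $\Box(A\to B)\to(\Box A\to\Box B)$; $\mathbf{L3}$: $\Box(\Box A\to A)\to\Box A$; $\mathbf{J3}$: $((A\rhd C)\land(B\rhd C))\to((A\lor B)\rhd C)$; $\mathbf{J6}$: $\Box A\leftrightarrow((\neg A)\rhd\bot)$. Its inference rules are Modus Ponens, Necessitation (from $A$ infer $\Box A$), $\mathbf{R1}$ (from $A\to B$ infer $(C\rhd A)\to(C\rhd B)$) and $\mathbf{R2}$ (from $A\to B$ infer $(B\rhd C)\to(A\rhd C)$). $\mathbf{IL}^-(\Sigma_1,\ldots,\Sigma_n)$ is the logic obtained from $\mathbf{IL}^-$ by adding the schemata $\Sigma_1,\ldots,\Sigma_n$ as axiom schemata (with the same rules). $\mathbf{J1}$ is the schema $\Box(A\to B)\to(A\rhd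 B)$ and $\mathbf{J5}$ is the schema $\Diamond A\rhd A$. A logic is identified with its set of theorems, and is assumed closed under Modus Ponens, Necessitation and substitution of formulas for propositional variables; $L\subseteq L'$ means that every theorem of $L$ is a theorem of $L'$, and $L\vdash A$ means that $A$ is a theorem of $L$. A formula $A$ is left-modalized in $p$ if every occurrence of $p$ in $A$ is in the scope of some $\Box$ or $\rhd$, and $p\notin v(C)$ for any subformula $B\rhd C$ of $A$. $L$ has $\ell$FPP if for any formula $A(p)$ which is left-modalized in $p$, there exists a formula $F$ such that $v(F)\subseteq v(A)\setminus\{p\}$ and $L\vdash F\leftrightarrow A(F)$. $L$ has CIP if for any formulas $A$ and $B$ with $L\vdash A\to B$, there exists a formula $C$ such that $v(C)\subseteq v(A)\cap v(B)$, $L\vdash A\to C$ and $L\vdash C\to B$. *)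

theory Defs
  imports Main
begin

datatype fm =
    Bot ("\<^bold>\<bottom>")
  | Var nat
  | Imp fm fm (infixr "\<^bold>\<rightarrow>" 55)
  | Box fm ("\<box>_" [90] 90)
  | Rhd fm fm (infix "\<rhd>" 70)

abbreviation Neg :: "fm \<Rightarrow> fm" ("\<^bold>\<not>_" [90] 90) where
  "\<^bold>\<not>A \<equiv> A \<^bold>\<rightarrow> \<^bold>\<bottom>"

abbreviation Disj :: "fm \<Rightarrow> fm \<Rightarrow> fm" (infixr "\<^bold>\<or>" 75) where
  "A \<^bold>\<or> B \<equiv> \<^bold>\<not>A \<^bold>\<rightarrow> B"

abbreviation Conj :: "fm \<Rightarrow> fm \<Rightarrow> fm" (infixr "\<^bold>\<and>" 80) where
  "A \<^bold>\<and> B \<equiv> \<^bold>\<not>(A \<^bold>\<rightarrow> \<^bold>\<not>B)"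

abbreviation Iff :: "fm \<Rightarrow> fm \<Rightarrow> fm" (infix "\<^bold>\<leftrightarrow>" 54) where
  "A \<^bold>\<leftrightarrow> B \<equiv> (A \<^bold>\<rightarrow> B) \<^bold>\<and> (B \<^bold>\<rightarrow> A)"

abbreviation Dia :: "fm \<Rightarrow> fm" ("\<diamond>_" [90] 90) where
  "\<diamond>A \<equiv> \<^bold>\<not>\<box>\<^bold>\<not>A"

primrec vars :: "fm \<Rightarrow> nat set" where
  "vars \<^bold>\<bottom> = {}"
| "vars (Var q) = {q}"
| "vars (A \<^bold>\<rightarrow> B) = vars A \<union> vars B"
| "vars (\<box>A) = vars A"
| "vars (A \<rhd> B) = vars A \<union> vars B"

primrec subst :: "(nat \<Rightarrow> fm) \<Rightarrow> fm \<Rightarrow> fm" where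
  "subst \<sigma> \<^bold>\<bottom> = \<^bold>\<bottom>"
| "subst \<sigma> (Var q) = \<sigma> q"
| "subst \<sigma> (A \<^bold>\<rightarrow> B) = subst \<sigma> A \<^bold>\<rightarrow> subst \<sigma> B"
| "subst \<sigma> (\<box>A) = \<box>(subst \<sigma> A)"
| "subst \<sigma> (A \<rhd> B) = subst \<sigma> A \<rhd> subst \<sigma> B"

abbreviation subst1 :: "nat \<Rightarrow> fm \<Rightarrow> fm \<Rightarrow> fm" where
  "subst1 p B \<equiv> subst (Var(p := B))"

primrec subformulas :: "fm \<Rightarrow> fm set" where
  "subformulas \<^bold>\<bottom> = {\<^bold>\<bottom>}"
| "subformulas (Var q) = {Var q}"
| "subformulas (A \<^bold>\<rightarrow> B) = insert (A \<^bold>\<rightarrow> B) (subformulas A \<union> subformulas B)"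
| "subformulas (\<box>A) = insert (\<box>A) (subformulas A)"
| "subformulas (A \<rhd> B) = insert (A \<rhd> B) (subformulas A \<union> subformulas B)"

text \<open>Boolean evaluation in which the variables and all formulas \<open>\<box>A\<close>, \<open>A \<rhd> B\<close>
  count as propositional atoms; \<open>t\<close> is only consulted at such formulas.\<close>

primrec bool_eval :: "(fm \<Rightarrow> bool) \<Rightarrow> fm \<Rightarrow> bool" where
  "bool_eval t \<^bold>\<bottom> = False"
| "bool_eval t (Var q) = t (Var q)"
| "bool_eval t (A \<^bold>\<rightarrow> B) = (bool_eval t A \<longrightarrow> bool_eval t B)"
| "bool_eval t (\<box>A) = t (\<box>A)"
| "bool_eval t (A \<rhd> B) = t (A \<rhd> B)"

definition tautology :: "fm \<Rightarrow> bool" where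
  "tautology A \<longleftrightarrow> (\<forall>t. bool_eval t A)"

text \<open>\<open>IL_minus \<Sigma>\<close> is the set of theorems of the logic obtained from IL\<open>\<^sup>-\<close> by adding all
  members of \<open>\<Sigma>\<close> (the set of all instances of the additional schemata) as axioms.\<close>

inductive_set IL_minus :: "fm set \<Rightarrow> fm set" for \<Sigma> :: "fm set" where
  L1: "tautology A \<Longrightarrow> A \<in> IL_minus \<Sigma>"
| L2: "\<box>(A \<^bold>\<rightarrow> B) \<^bold>\<rightarrow> (\<box>A \<^bold>\<rightarrow> \<box>B) \<in> IL_minus \<Sigma>"
| L3: "\<box>(\<box>A \<^bold>\<rightarrow> A) \<^bold>\<rightarrow> \<box>A \<in> IL_minus \<Sigma>"
| J3: "((A \<rhd> C) \<^bold>\<and> (B \<rhd> C)) \<^bold>\<rightarrow> ((A \<^bold>\<or> B) \<rhd> C) \<in> IL_minus \<Sigma>"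
| J6: "\<box>A \<^bold>\<leftrightarrow> ((\<^bold>\<not>A) \<rhd> \<^bold>\<bottom>) \<in> IL_minus \<Sigma>"
| Ax: "A \<in> \<Sigma> \<Longrightarrow> A \<in> IL_minus \<Sigma>"
| MP: "A \<^bold>\<rightarrow> B \<in> IL_minus \<Sigma> \<Longrightarrow> A \<in> IL_minus \<Sigma> \<Longrightarrow> B \<in> IL_minus \<Sigma>"
| Nec: "A \<in> IL_minus \<Sigma> \<Longrightarrow> \<box>A \<in> IL_minus \<Sigma>"
| R1: "A \<^bold>\<rightarrow> B \<in> IL_minus \<Sigma> \<Longrightarrow> (C \<rhd> A) \<^bold>\<rightarrow> (C \<rhd> B) \<in> IL_minus \<Sigma>"
| R2: "A \<^bold>\<rightarrow> B \<in> IL_minus \<Sigma> \<Longrightarrow> (B \<rhd> C) \<^bold>\<rightarrow> (A \<rhd> C) \<in> IL_minus \<Sigma>"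

definition J1_schema :: "fm set" where
  "J1_schema = {\<box>(A \<^bold>\<rightarrow> B) \<^bold>\<rightarrow> (A \<rhd> B) | A B. True}"

definition J5_schema :: "fm set" where
  "J5_schema = {(\<diamond>A) \<rhd> A | A. True}"

text \<open>Closure under R1 and R2 is deliberately not part of being a logic.\<close>

definition is_logic :: "fm set \<Rightarrow> bool" where
  "is_logic L \<longleftrightarrow>
     (\<forall>A B. A \<^bold>\<rightarrow> B \<in> L \<longrightarrow> A \<in> L \<longrightarrow> B \<in> L) \<and>
     (\<forall>A. A \<in> L \<longrightarrow> \<box>A \<in> L) \<and>
     (\<forall>A \<sigma>. A \<in> L \<longrightarrow> subst \<sigma> A \<in> L)"

text \<open>\<open>modalized p A\<close>: every occurrence of \<open>p\<close> in \<open>A\<close> is in the scope of some \<open>\<box>\<close> or \<open>\<rhd>\<close>.\<close>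

primrec modalized :: "nat \<Rightarrow> fm \<Rightarrow> bool" where
  "modalized p \<^bold>\<bottom> = True"
| "modalized p (Var q) = (q \<noteq> p)"
| "modalized p (A \<^bold>\<rightarrow> B) = (modalized p A \<and> modalized p B)"
| "modalized p (\<box>A) = True"
| "modalized p (A \<rhd> B) = True"

definition left_modalized :: "nat \<Rightarrow> fm \<Rightarrow> bool" where
  "left_modalized p A \<longleftrightarrow>
     modalized p A \<and> (\<forall>B C. B \<rhd> C \<in> subformulas A \<longrightarrow> p \<notin> vars C)"

definition has_lFPP :: "fm set \<Rightarrow> bool" where
  "has_lFPP L \<longleftrightarrow>
     (\<forall>p A. left_modalized p A \<longrightarrow>
        (\<exists>F. vars F \<subseteq> vars A - {p} \<and> (F \<^bold>\<leftrightarrow> subst1 p F A) \<in> L))"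

definition has_CIP :: "fm set \<Rightarrow> bool" where
  "has_CIP L \<longleftrightarrow>
     (\<forall>A B. A \<^bold>\<rightarrow> B \<in> L \<longrightarrow>
        (\<exists>C. vars C \<subseteq> vars A \<inter> vars B \<and> A \<^bold>\<rightarrow> C \<in> L \<and> C \<^bold>\<rightarrow> B \<in> L))"

end

theory Submission
  imports Defs
begin

text \<open>The fixed points of \<open>p \<rhd> q\<close> are provably unique already in \<open>IL\<^sup>-\<close>, so an interpolant for the
  uniqueness statement would, like an explicit fixed point, define \<open>p\<close> by a formula in \<open>q\<close>.
  Consider the chain of worlds \<open>\<dots> R 2 R 1 R 0\<close> (transitively closed), together with one isolated
  world \<open>w\<close>, the only world at which \<open>q\<close> holds. Let \<open>m S\<^sub>n k\<close> for all \<open>k \<le> m < n\<close>, and \<open>m S\<^sub>n w\<close> for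
  all \<open>m < n - 1\<close>. This frame validates J1 and J5, and a fixed point \<open>p\<close> of \<open>p \<rhd> q\<close> holds at \<open>n\<close> if
  and only if it fails at \<open>n - 1\<close>, so its truth value alternates along the chain. But every formula
  containing no variable other than \<open>q\<close> has an eventually constant truth value on the chain.\<close>

section \<open>Veltman semantics\<close>

text \<open>No frame condition is imposed on \<open>S\<close>; in particular a witness
  \<open>z\<close> need not be an \<open>R\<close>-successor of \<open>x\<close>. The chain model
  relies on this: its isolated world is an \<open>S\<close>-witness but never an
  \<open>R\<close>-successor.\<close>

primrec sat :: "('w \<Rightarrow> 'w \<Rightarrow> bool) \<Rightarrow> ('w \<Rightarrow> 'w \<Rightarrow> 'w \<Rightarrow> bool) \<Rightarrow> (nat \<Rightarrow> 'w set) \<Rightarrow> fm \<Rightarrow> 'w \<Rightarrow> bool"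
where
  "sat R S V \<^bold>\<bottom> x = False"
| "sat R S V (Var q) x = (x \<in> V q)"
| "sat R S V (A \<^bold>\<rightarrow> B) x = (sat R S V A x \<longrightarrow> sat R S V B x)"
| "sat R S V (\<box>A) x = (\<forall>y. R x y \<longrightarrow> sat R S V A y)"
| "sat R S V (A \<rhd> B) x =
     (\<forall>y. R x y \<longrightarrow> sat R S V A y \<longrightarrow> (\<exists>z. S x y z \<and> sat R S V B z))"

lemma bool_eval_sat: "bool_eval (\<lambda>B. sat R S V B x) A = sat R S V A x"
  by (induction A) auto

lemma sat_tautology:
  assumes "tautology A"
  shows "sat R S V A x"
proof -
  have "bool_eval (\<lambda>B. sat R S V B x) A"
    using assms by (simp add: tautology_def)
  then show ?thesis by (simp only: bool_eval_sat)
qed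

lemma sat_Loeb:
  assumes trans: "transp R"
    and wf: "wfp (\<lambda>y x. R x y)"
    and step: "sat R S V (\<box>(\<box>A \<^bold>\<rightarrow> A)) x"
  shows "sat R S V (\<box>A) x"
proof -
  have "R x y \<longrightarrow> sat R S V A y" for y
    using wf
  proof (induction y rule: wfp_induct_rule)
    case (less y)
    show ?case
    proof
      assume "R x y"
      then have "sat R S V (\<box>A) y"
        using less transpD[OF trans] unfolding sat.simps by blast
      then show "sat R S V A y"
        using step \<open>R x y\<close> unfolding sat.simps by blast
    qed
  qed
  then show ?thesis by simp
qed

text \<open>For J1 the successor \<open>y\<close> is its own witness; for J5 an
  \<open>R\<close>-successor of \<open>y\<close> that satisfies the right-hand formula serves as
  one.\<close>

lemma soundness_J1_J5:
  assumes trans: "transp R"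
    and wf: "wfp (\<lambda>y x. R x y)"
    and J1: "\<And>x y. R x y \<Longrightarrow> S x y y"
    and J5: "\<And>x y z. R x y \<Longrightarrow> R y z \<Longrightarrow> S x y z"
    and "A \<in> IL_minus (J1_schema \<union> J5_schema)"
  shows "sat R S V A x"
  using assms(5)
proof (induction arbitrary: x)
  case (L1 A)
  then show ?case by (rule sat_tautology)
next
  case (L3 A)
  have "sat R S V (\<box>A) x" if "sat R S V (\<box>(\<box>A \<^bold>\<rightarrow> A)) x"
    using trans wf that by (rule sat_Loeb)
  then show ?case by (subst sat.simps(3)) (rule impI)
next
  case (Ax A)
  then consider B C where "A = \<box>(B \<^bold>\<rightarrow> C) \<^bold>\<rightarrow> (B \<rhd> C)" | B where "A = (\<diamond>B) \<rhd> B"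
    unfolding J1_schema_def J5_schema_def by blast
  then show ?case
    by cases (use J1 J5 in \<open>simp; blast\<close>)+
next
  case (R1 A B C)
  then show ?case by (simp; blast)
next
  case (J3 A C B)
  show ?case by (simp; blast)
next
  case (J6 A)
  show ?case by simp
qed simp_all

section \<open>Uniqueness of fixed points\<close>

lemma IL_taut_MP: "A \<in> IL_minus \<Sigma> \<Longrightarrow> tautology (A \<^bold>\<rightarrow> B) \<Longrightarrow> B \<in> IL_minus \<Sigma>"
  by (metis IL_minus.L1 IL_minus.MP)

lemma IL_taut_MP2:
  "A \<in> IL_minus \<Sigma> \<Longrightarrow> B \<in> IL_minus \<Sigma> \<Longrightarrow> tautology (A \<^bold>\<rightarrow> B \<^bold>\<rightarrow> C) \<Longrightarrow> C \<in> IL_minus \<Sigma>"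
  by (metis IL_minus.L1 IL_minus.MP)

lemma IL_Box_mono: "A \<^bold>\<rightarrow> B \<in> IL_minus \<Sigma> \<Longrightarrow> \<box>A \<^bold>\<rightarrow> \<box>B \<in> IL_minus \<Sigma>"
  by (metis IL_minus.L2 IL_minus.MP IL_minus.Nec)

text \<open>An internalised R2, obtained without J1. By J6 and R1, \<open>Box D\<close> yields
  \<open>Neg D \<rhd> C\<close>; J3 joins this with \<open>B \<rhd> C\<close>, and R2 applies
  because \<open>A\<close> implies \<open>Neg D\<close> or \<open>B\<close>.\<close>

lemma IL_Rhd_antimono:
  assumes "D \<^bold>\<rightarrow> (A \<^bold>\<rightarrow> B) \<in> IL_minus \<Sigma>"
  shows "\<box>D \<^bold>\<rightarrow> (B \<rhd> C \<^bold>\<rightarrow> A \<rhd> C) \<in> IL_minus \<Sigma>"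
proof -
  have "(\<^bold>\<not>D) \<rhd> \<^bold>\<bottom> \<^bold>\<rightarrow> (\<^bold>\<not>D) \<rhd> C \<in> IL_minus \<Sigma>"
    by (intro IL_minus.R1 IL_minus.L1) (simp add: tautology_def)
  then have 1: "\<box>D \<^bold>\<rightarrow> (\<^bold>\<not>D) \<rhd> C \<in> IL_minus \<Sigma>"
    by (rule IL_taut_MP2[OF IL_minus.J6[of D]]) (simp add: tautology_def)
  have "A \<^bold>\<rightarrow> (\<^bold>\<not>D \<^bold>\<or> B) \<in> IL_minus \<Sigma>"
    by (rule IL_taut_MP[OF assms]) (simp add: tautology_def)
  then have "(\<^bold>\<not>D \<^bold>\<or> B) \<rhd> C \<^bold>\<rightarrow> A \<rhd> C \<in> IL_minus \<Sigma>"
    by (rule IL_minus.R2)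
  then have "((\<^bold>\<not>D) \<rhd> C) \<^bold>\<and> (B \<rhd> C) \<^bold>\<rightarrow> A \<rhd> C \<in> IL_minus \<Sigma>"
    by (rule IL_taut_MP2[OF IL_minus.J3[of "\<^bold>\<not>D" C B]]) (simp add: tautology_def)
  with 1 show ?thesis
    by (rule IL_taut_MP2) (simp add: tautology_def)
qed

text \<open>Boxing the premise turns \<open>Box X\<close> into the hypothesis of L3 for
  \<open>D\<close>. This gives \<open>Box D\<close>, and \<open>X\<close> then gives
  \<open>D\<close>.\<close>

lemma IL_Loeb_rule:
  assumes "X \<^bold>\<rightarrow> (\<box>D \<^bold>\<rightarrow> D) \<in> IL_minus \<Sigma>"
  shows "X \<^bold>\<rightarrow> (\<box>X \<^bold>\<rightarrow> D) \<in> IL_minus \<Sigma>"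
proof -
  have "\<box>X \<^bold>\<rightarrow> \<box>D \<in> IL_minus \<Sigma>"
    by (rule IL_taut_MP2[OF IL_Box_mono[OF assms] IL_minus.L3[of D]]) (simp add: tautology_def)
  then show ?thesis
    by (rule IL_taut_MP2[OF assms]) (simp add: tautology_def)
qed

text \<open>Antimonotonicity in both directions shows that \<open>P \<rhd> Q\<close> and
  \<open>P' \<rhd> Q\<close> agree once \<open>P\<close> and \<open>P'\<close> agree at all
  successors, so the Loeb rule applies. Everything about \<open>P\<close> stands on the left and
  everything about \<open>P'\<close> on the right, as interpolation requires.\<close>

lemma IL_Rhd_fixpoint_unique:
  defines "X \<equiv> \<lambda>P Q. P \<^bold>\<leftrightarrow> P \<rhd> Q"
  shows "(P \<^bold>\<and> X P Q \<^bold>\<and> \<box>X P Q) \<^bold>\<rightarrow> ((X P' Q \<^bold>\<and> \<box>X P' Q) \<^bold>\<rightarrow> P') \<in> IL_minus \<Sigma>"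
proof -
  let ?D = "P \<^bold>\<leftrightarrow> P'" and ?X = "X P Q \<^bold>\<and> X P' Q"
  have "\<box>?D \<^bold>\<rightarrow> (P' \<rhd> Q \<^bold>\<rightarrow> P \<rhd> Q) \<in> IL_minus \<Sigma>"
    by (intro IL_Rhd_antimono IL_minus.L1) (simp add: tautology_def)
  moreover have "\<box>?D \<^bold>\<rightarrow> (P \<rhd> Q \<^bold>\<rightarrow> P' \<rhd> Q) \<in> IL_minus \<Sigma>"
    by (intro IL_Rhd_antimono IL_minus.L1) (simp add: tautology_def)
  ultimately have "?X \<^bold>\<rightarrow> (\<box>?D \<^bold>\<rightarrow> ?D) \<in> IL_minus \<Sigma>"
    by (rule IL_taut_MP2) (unfold tautology_def X_def bool_eval.simps, blast)
  then have unique: "?X \<^bold>\<rightarrow> (\<box>?X \<^bold>\<rightarrow> ?D) \<in> IL_minus \<Sigma>"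
    by (rule IL_Loeb_rule)
  \<comment> \<open>The Loeb rule needs the box of the conjunction \<open>?X\<close>; currying
    separates it into one boxed hypothesis for each fixed point.\<close>
  have "X P Q \<^bold>\<rightarrow> (X P' Q \<^bold>\<rightarrow> ?X) \<in> IL_minus \<Sigma>"
    by (intro IL_minus.L1) (simp add: tautology_def)
  then have "\<box>X P Q \<^bold>\<rightarrow> \<box>(X P' Q \<^bold>\<rightarrow> ?X) \<in> IL_minus \<Sigma>"
    by (rule IL_Box_mono)
  then have "\<box>X P Q \<^bold>\<rightarrow> (\<box>X P' Q \<^bold>\<rightarrow> \<box>?X) \<in> IL_minus \<Sigma>"
    by (rule IL_taut_MP2[OF _ IL_minus.L2[of "X P' Q" ?X]]) (simp add: tautology_def)
  then show ?thesis
    by (rule IL_taut_MP2[OF unique]) (unfold tautology_def bool_eval.simps, blast)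
qed

section \<open>The chain model\<close>

text \<open>\<open>Some n\<close> is the world \<open>n\<close> of the chain and \<open>None\<close> is the world \<open>w\<close>.\<close>

definition chain_R :: "nat option \<Rightarrow> nat option \<Rightarrow> bool" where
  "chain_R x y \<longleftrightarrow> (\<exists>n m. x = Some n \<and> y = Some m \<and> m < n)"

definition chain_S :: "nat option \<Rightarrow> nat option \<Rightarrow> nat option \<Rightarrow> bool" where
  "chain_S x y z \<longleftrightarrow> (\<exists>n m. x = Some n \<and> y = Some m \<and> m < n \<and>
     (case z of None \<Rightarrow> Suc m < n | Some k \<Rightarrow> k \<le> m))"

abbreviation chain_sat :: "(nat \<Rightarrow> nat option set) \<Rightarrow> fm \<Rightarrow> nat option \<Rightarrow> bool" where
  "chain_sat \<equiv> sat chain_R chain_S"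

lemma wfp_chain_R: "wfp (\<lambda>y x. chain_R x y)"
proof -
  have "wfp (\<lambda>y x. case_option 0 Suc y < case_option 0 Suc x)"
    by (rule wfp_if_convertible_to_nat)
  then show ?thesis
    by (rule wfp_subset) (auto simp: chain_R_def)
qed

lemma chain_soundness:
  assumes "A \<in> IL_minus (J1_schema \<union> J5_schema)"
  shows "chain_sat V A x"
  by (rule soundness_J1_J5[OF _ wfp_chain_R _ _ assms])
    (auto intro!: transpI simp: chain_R_def chain_S_def)

lemma chain_sat_Box_Some: "chain_sat V (\<box>A) (Some n) \<longleftrightarrow> (\<forall>m<n. chain_sat V A (Some m))"
  by (auto simp: chain_R_def)

lemma chain_sat_Rhd_Some:
  "chain_sat V (A \<rhd> B) (Some n) \<longleftrightarrow> (\<forall>m<n. chain_sat V A (Some m) \<longrightarrow>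
     (\<exists>k\<le>m. chain_sat V B (Some k)) \<or> Suc m < n \<and> chain_sat V B None)"
proof -
  have "(\<exists>z. chain_S (Some n) (Some m) z \<and> Q z) \<longleftrightarrow>
      (\<exists>k\<le>m. Q (Some k)) \<or> Suc m < n \<and> Q None" if "m < n" for m Q
    using that by (auto simp: chain_S_def split_option_ex)
  then show ?thesis by (simp add: chain_R_def split_option_all)
qed

lemma eventually_constant_antimono:
  fixes P :: "nat \<Rightarrow> bool"
  assumes "\<And>m n. m \<le> n \<Longrightarrow> P n \<Longrightarrow> P m"
  shows "\<exists>N b. \<forall>n\<ge>N. P n = b"
proof (cases "\<forall>n. P n")
  case False
  then obtain N where "\<not> P N" by blast
  then have "\<forall>n\<ge>N. P n = False" using assms by blast
  then show ?thesis by blast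
qed auto

text \<open>Only \<open>\<rhd>\<close> is delicate. If \<open>B\<close> fails at
  \<open>None\<close>, raising \<open>n\<close> merely adds requirements, so truth is
  antimonotone.\<close>

lemma chain_sat_eventually_constant:
  assumes "vars F \<subseteq> {q}" and "V q = {None}"
  shows "\<exists>N b. \<forall>n\<ge>N. chain_sat V F (Some n) = b"
  using assms(1)
proof (induction F)
  case (Imp A B)
  then obtain N b N' b' where "\<forall>n\<ge>N. chain_sat V A (Some n) = b"
    "\<forall>n\<ge>N'. chain_sat V B (Some n) = b'" by auto
  then have "\<forall>n\<ge>max N N'. chain_sat V (A \<^bold>\<rightarrow> B) (Some n) = (b \<longrightarrow> b')" by simp
  then show ?case by blast
next
  case (Box A)
  show ?case
    unfolding chain_sat_Box_Some by (rule eventually_constant_antimono) auto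
next
  case (Rhd A B)
  show ?case
  proof (cases "chain_sat V B None")
    case False
    then show ?thesis
      unfolding chain_sat_Rhd_Some by (intro eventually_constant_antimono) auto
  next
    \<comment> \<open>Now \<open>None\<close> serves every \<open>m\<close> except the immediate
      predecessor, so truth at \<open>Suc n\<close> depends only on \<open>A\<close> at
      \<open>n\<close> and on whether \<open>B\<close> holds somewhere up to
      \<open>n\<close>.\<close>
    case True
    obtain N b where A: "\<forall>n\<ge>N. chain_sat V A (Some n) = b"
      using Rhd by auto
    have step: "chain_sat V (A \<rhd> B) (Some (Suc n)) \<longleftrightarrow>
        (chain_sat V A (Some n) \<longrightarrow> (\<exists>k\<le>n. chain_sat V B (Some k)))" for n
      unfolding chain_sat_Rhd_Some using True by (auto simp: less_Suc_eq)
    obtain K c where K: "\<forall>n\<ge>K. (\<forall>k\<le>n. \<not> chain_sat V B (Some k)) = c"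
      using eventually_constant_antimono[of "\<lambda>n. \<forall>k\<le>n. \<not> chain_sat V B (Some k)"]
        order_trans by blast
    have "chain_sat V (A \<rhd> B) (Some n) = (b \<longrightarrow> \<not> c)" if "n \<ge> Suc (max N K)" for n
    proof -
      from that obtain n' where "n = Suc n'" "n' \<ge> N" "n' \<ge> K"
        by (cases n) auto
      then show ?thesis using step A K by blast
    qed
    then show ?thesis by blast
  qed
qed (use assms(2) in auto)

lemma not_chain_sat_iff_even:
  assumes "vars F \<subseteq> {q}" and "V q = {None}"
  shows "\<exists>n. chain_sat V F (Some n) \<noteq> even n"
proof -
  obtain N b where "\<forall>n\<ge>N. chain_sat V F (Some n) = b"
    using chain_sat_eventually_constant[of F q V] assms by blast
  then have "chain_sat V F (Some N) = chain_sat V F (Some (Suc N))" by simp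
  then show ?thesis by (metis even_Suc)
qed

lemma chain_sat_Rhd_Var_0: "chain_sat V (P \<rhd> Var q) (Some 0)"
  unfolding chain_sat_Rhd_Some by simp

text \<open>The only world satisfying \<open>q\<close> is a witness for every \<open>m\<close> below
  \<open>n\<close> but not for \<open>n\<close> itself; this is the source of the negation.\<close>

lemma chain_sat_Rhd_Var_Suc:
  assumes "V q = {None}"
  shows "chain_sat V (P \<rhd> Var q) (Some (Suc n)) \<longleftrightarrow> \<not> chain_sat V P (Some n)"
proof -
  have "chain_sat V (P \<rhd> Var q) (Some (Suc n)) \<longleftrightarrow>
      (\<forall>m<Suc n. chain_sat V P (Some m) \<longrightarrow> Suc m < Suc n)"
    unfolding chain_sat_Rhd_Some by (simp add: assms)
  also have "\<dots> \<longleftrightarrow> \<not> chain_sat V P (Some n)"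
    using less_antisym by blast
  finally show ?thesis .
qed

lemma sat_Iff: "sat R S V (A \<^bold>\<leftrightarrow> B) x \<longleftrightarrow> (sat R S V A x \<longleftrightarrow> sat R S V B x)"
  unfolding sat.simps by blast

lemma chain_fixpoint_iff_even:
  assumes "V q = {None}" and "\<And>n. chain_sat V (P \<^bold>\<leftrightarrow> P \<rhd> Var q) (Some n)"
  shows "chain_sat V P (Some n) \<longleftrightarrow> even n"
proof (induction n)
  case 0
  show ?case
    using assms(2)[of 0] chain_sat_Rhd_Var_0 unfolding sat_Iff by simp
next
  case (Suc n)
  then show ?case
    using assms(2)[of "Suc n"]
    unfolding sat_Iff chain_sat_Rhd_Var_Suc[of V q P n, OF assms(1)] by simp
qed

lemma chain_sat_even_fixpoint:
  assumes "V q = {None}" and "V p = Some ` {n. even n}"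
  shows "chain_sat V (Var p \<^bold>\<leftrightarrow> Var p \<rhd> Var q) (Some n)"
proof (cases n)
  case 0
  show ?thesis
    unfolding sat_Iff 0 using chain_sat_Rhd_Var_0[of V "Var p" q] assms(2) by (simp del: sat.simps(5))
next
  case (Suc m)
  show ?thesis
    unfolding sat_Iff Suc chain_sat_Rhd_Var_Suc[of V q "Var p" m, OF assms(1)]
    using assms(2) by (simp add: image_iff)
qed

theorem corollary6p4:
  fixes L :: "fm set"
  assumes "is_logic L"
    and "IL_minus {} \<subseteq> L"
    and "L \<subseteq> IL_minus (J1_schema \<union> J5_schema)"
  shows "\<not> has_lFPP L \<and> \<not> has_CIP L"
proof
  \<comment> \<open>Variable 1 plays \<open>q\<close>; variables 0 and 2 are two copies of
    \<open>p\<close> with the same valuation, so one model serves both refutations.\<close>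
  define V where "V = (\<lambda>i::nat. if i = 1 then {None} else Some ` {n::nat. even n})"
  have q: "V 1 = {None}" and p: "V 0 = Some ` {n. even n}" and r: "V 2 = Some ` {n. even n}"
    by (simp_all add: V_def)
  have sound: "chain_sat V A x" if "A \<in> L" for A x
    using chain_soundness that assms(3) by blast
  show "\<not> has_lFPP L"
  proof
    have "left_modalized 0 (Var 0 \<rhd> Var 1)"
      by (simp add: left_modalized_def)
    moreover assume "has_lFPP L"
    ultimately obtain F where F: "vars F \<subseteq> vars (Var 0 \<rhd> Var 1) - {0}"
      "(F \<^bold>\<leftrightarrow> subst1 0 F (Var 0 \<rhd> Var 1)) \<in> L"
      unfolding has_lFPP_def by blast
    from F(2) have "F \<^bold>\<leftrightarrow> F \<rhd> Var 1 \<in> L" by simp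
    from sound[OF this] have "chain_sat V F (Some n) \<longleftrightarrow> even n" for n
      by (rule chain_fixpoint_iff_even[of V 1 F, OF q])
    moreover have "vars F \<subseteq> {1}" using F(1) by auto
    ultimately show False using not_chain_sat_iff_even q by blast
  qed
  show "\<not> has_CIP L"
  proof
    let ?X = "\<lambda>P. P \<^bold>\<leftrightarrow> P \<rhd> Var 1"
    let ?A = "Var 0 \<^bold>\<and> ?X (Var 0) \<^bold>\<and> \<box>?X (Var 0)"
    let ?B = "(?X (Var 2) \<^bold>\<and> \<box>?X (Var 2)) \<^bold>\<rightarrow> Var 2"
    have "?A \<^bold>\<rightarrow> ?B \<in> L"
      using IL_Rhd_fixpoint_unique assms(2) by blast
    moreover assume "has_CIP L"
    ultimately obtain C where C: "vars C \<subseteq> vars ?A \<inter> vars ?B" "?A \<^bold>\<rightarrow> C \<in> L" "C \<^bold>\<rightarrow> ?B \<in> L"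
      unfolding has_CIP_def by blast
    have X: "chain_sat V (?X (Var i)) (Some n)" "chain_sat V (\<box>?X (Var i)) (Some n)"
      if "V i = Some ` {n. even n}" for i n
      using chain_sat_even_fixpoint[OF q that] unfolding chain_sat_Box_Some by blast+
    \<comment> \<open>At even worlds \<open>?A\<close> holds and forces \<open>C\<close>. At odd
      worlds the premise of \<open>?B\<close> holds but \<open>Var 2\<close> fails, so
      \<open>C\<close> must fail.\<close>
    have "chain_sat V C (Some n) \<longleftrightarrow> even n" for n
    proof
      assume "even n"
      then show "chain_sat V C (Some n)"
        using sound[OF C(2), of "Some n"] X[OF p, of n] p by (simp del: sat.simps(4,5))
    next
      assume "chain_sat V C (Some n)"
      then show "even n"
        using sound[OF C(3), of "Some n"] X[OF r, of n] r by (auto simp del: sat.simps(4,5))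
    qed
    moreover have "vars C \<subseteq> {1}" using C(1) by auto
    ultimately show False using not_chain_sat_iff_even q by blast
  qed
qed

end
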